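(* Let $P$ be a finite poset. The restriction of the enriched transfer map $\Phi^{(e)}$ to the order polytope $\mathcal{O}(P)$ coincides with the restriction of the transfer map $\Phi$ to $\mathcal{O}(P)$.
   Context: $\mathbb{R}^P$ is the set of real-valued functions on $P$. The order polytope $\mathcal{O}(P)$ is the set of $f\in\mathbb{R}^P$ with $0\le f(v)\le 1$ for all $v\in P$ and $f(x)\le f(y)$ whenever $x<y$ in $P$. The transfer map $\Phi:\mathbb{R}^P\to\mathbb{R}^P$ is $(\Phi f)(v)=f(v)$ if $v$ is minimal in $P$, and $(\Phi f)(v)=f(v)-\max\{f(w): v \text{ covers } w \text{ in } P\}$ otherwise. The enriched transfer map $\Phi^{(e)}:\mathbb{R}^P\to\mathbb{R}^P$ is defined inductively on the ordering of $P$ by $(\Phi^{(e)}f)(v)=f(v)$ if $v$ is minimal in $P$, and $(\Phi^{(e)}f)(v)=f(v)-\max\{\sum_{i=1}^r|(\Phi^{(e)}f)(v_i)| : v>v_1>\dots>v_r \text{ a chain in } P\}$ otherwise. *)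

theory Defs
  imports Complex_Main "HOL-Library.FuncSet"
begin

text \<open>
  A finite poset is a finite carrier \<open>P\<close> with a partial order \<open>r\<close> on it. The space of real-valued
  functions on \<open>P\<close> is \<open>P \<rightarrow>\<^sub>E UNIV\<close>: functions are \<open>undefined\<close> outside \<open>P\<close>, so that HOL equality
  of two of its elements is equality of functions on \<open>P\<close>.
\<close>

locale finite_poset =
  fixes P :: "'a set" and r :: "'a rel"
  assumes finite_carrier: "finite P"
    and partial_order: "partial_order_on P r"
begin

definition lt :: "'a \<Rightarrow> 'a \<Rightarrow> bool" (infix "\<sqsubset>" 50) where
  "x \<sqsubset> y \<longleftrightarrow> (x, y) \<in> r \<and> x \<noteq> y"

definition minimal :: "'a \<Rightarrow> bool" where
  "minimal v \<longleftrightarrow> v \<in> P \<and> \<not> (\<exists>w\<in>P. w \<sqsubset> v)"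

definition covers :: "'a \<Rightarrow> 'a \<Rightarrow> bool" where
  "covers v w \<longleftrightarrow> v \<in> P \<and> w \<in> P \<and> w \<sqsubset> v \<and> \<not> (\<exists>u\<in>P. w \<sqsubset> u \<and> u \<sqsubset> v)"

definition order_polytope :: "('a \<Rightarrow> real) set" where
  "order_polytope =
    {f \<in> P \<rightarrow>\<^sub>E UNIV. (\<forall>v\<in>P. 0 \<le> f v \<and> f v \<le> 1) \<and> (\<forall>x\<in>P. \<forall>y\<in>P. x \<sqsubset> y \<longrightarrow> f x \<le> f y)}"

definition transfer :: "('a \<Rightarrow> real) \<Rightarrow> ('a \<Rightarrow> real)" where
  "transfer f =
    (\<lambda>v\<in>P. if minimal v then f v else f v - Max (f ` {w \<in> P. covers v w}))"

text \<open>
  The lists \<open>[v\<^sub>1, \<dots>, v\<^sub>r]\<close> with \<open>r \<ge> 1\<close> and \<open>v \<sqsupset> v\<^sub>1 \<sqsupset> \<dots> \<sqsupset> v\<^sub>r\<close>; neither \<open>v\<close> covering \<open>v\<^sub>1\<close> nor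
  saturation of the chain is required.
\<close>

definition chains_below :: "'a \<Rightarrow> 'a list set" where
  "chains_below v = {vs. vs \<noteq> [] \<and> set vs \<subseteq> P \<and> sorted_wrt (\<lambda>x y. y \<sqsubset> x) (v # vs)}"

text \<open>For non-minimal \<open>v\<close>, both maxima are taken over finite nonempty sets.\<close>

lemma lt_trans: "x \<sqsubset> y \<Longrightarrow> y \<sqsubset> z \<Longrightarrow> x \<sqsubset> z"
  using partial_order unfolding lt_def partial_order_on_def preorder_on_def
  by (metis antisymD transD)

lemma lt_irrefl: "\<not> x \<sqsubset> x"
  by (simp add: lt_def)

lemma finite_chains_below: "finite (chains_below v)"
proof (rule finite_subset)
  show "chains_below v \<subseteq> {vs. set vs \<subseteq> P \<and> distinct vs}"
  proof
    fix vs assume "vs \<in> chains_below v"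
    then have "set vs \<subseteq> P" "sorted_wrt (\<lambda>x y. y \<sqsubset> x) vs"
      by (auto simp: chains_below_def)
    moreover from this(2) have "distinct vs"
      by (induction vs) (auto simp: lt_irrefl)
    ultimately show "vs \<in> {vs. set vs \<subseteq> P \<and> distinct vs}"
      by simp
  qed
  show "finite {vs. set vs \<subseteq> P \<and> distinct vs}"
    using finite_carrier by (rule finite_subset_distinct)
qed

lemma chains_below_nonempty:
  assumes "v \<in> P" "\<not> minimal v"
  shows "chains_below v \<noteq> {}"
proof -
  obtain w where "w \<in> P" "w \<sqsubset> v"
    using assms by (auto simp: minimal_def)
  then have "[w] \<in> chains_below v"
    by (simp add: chains_below_def)
  then show ?thesis by blast
qed

lemma card_down_less:
  assumes "w \<in> P" "w \<sqsubset> v"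
  shows "card {u \<in> P. u \<sqsubset> w} < card {u \<in> P. u \<sqsubset> v}"
proof (rule psubset_card_mono)
  have "w \<in> {u \<in> P. u \<sqsubset> v}" "w \<notin> {u \<in> P. u \<sqsubset> w}"
    using assms by (auto simp: lt_irrefl)
  moreover have "{u \<in> P. u \<sqsubset> w} \<subseteq> {u \<in> P. u \<sqsubset> v}"
    using assms by (auto intro: lt_trans)
  ultimately show "{u \<in> P. u \<sqsubset> w} \<subset> {u \<in> P. u \<sqsubset> v}"
    by blast
qed (simp add: finite_carrier)

lemma covered_nonempty:
  assumes "v \<in> P" "\<not> minimal v"
  shows "{w \<in> P. covers v w} \<noteq> {}"
proof -
  let ?h = "\<lambda>w. card {u \<in> P. u \<sqsubset> w}"
  let ?S = "{w \<in> P. w \<sqsubset> v}"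
  have S: "finite (?h ` ?S)" "?h ` ?S \<noteq> {}"
    using assms finite_carrier by (auto simp: minimal_def)
  obtain w where w: "w \<in> ?S" "?h w = Max (?h ` ?S)"
    using Max_in[OF S] by auto
  have "\<not> (w \<sqsubset> u \<and> u \<sqsubset> v)" if "u \<in> P" for u
  proof
    assume u: "w \<sqsubset> u \<and> u \<sqsubset> v"
    then have "?h u \<le> Max (?h ` ?S)"
      using that S by (intro Max_ge) auto
    moreover have "?h w < ?h u"
      using w u by (intro card_down_less) auto
    ultimately show False
      using w by simp
  qed
  with w assms show ?thesis
    by (auto simp: covers_def)
qed

function enriched_transfer :: "('a \<Rightarrow> real) \<Rightarrow> 'a \<Rightarrow> real" where
  "enriched_transfer f v =
    (if v \<in> P
     then if minimal v then f v
          else f v - Max ((\<lambda>vs. \<Sum>w\<leftarrow>vs. \<bar>enriched_transfer f w\<bar>) ` chains_below v)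
     else undefined)"
  by pat_completeness auto
termination
proof (relation "measure (\<lambda>(f, v). card {u \<in> P. u \<sqsubset> v})")
qed (auto simp: chains_below_def intro!: card_down_less)

declare enriched_transfer.simps [simp del]

end

end

theory Submission
  imports Defs
begin

text \<open>
  Let \<open>f\<close> be in the order polytope. By well-founded induction on \<open>v\<close>, the two maps agree at \<open>v\<close> with
  a nonnegative value, and the maximal weight of a chain with top element \<open>v\<close> is exactly \<open>f v\<close>: the
  weights telescope along a chain that always descends to a covered element with the largest value
  of \<open>f\<close>. Hence the maximum over the chains below \<open>v\<close> is the maximum of \<open>f\<close> over the elements
  below \<open>v\<close>, and by monotonicity this is attained at an element covered by \<open>v\<close>.
\<close>

context finite_poset
begin

text \<open>Among the elements below \<open>v\<close> that equal \<open>w\<close> or lie above it,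
  one with the most elements of \<open>P\<close> strictly below it is maximal, since this count
  grows strictly along the order; so \<open>v\<close> covers it.\<close>

lemma ex_cover_above:
  assumes "w \<in> P" "v \<in> P" "w \<sqsubset> v"
  shows "\<exists>u. covers v u \<and> (w = u \<or> w \<sqsubset> u)"
proof -
  let ?h = "\<lambda>u. card {x \<in> P. x \<sqsubset> u}"
  let ?S = "{u \<in> P. u \<sqsubset> v \<and> (w = u \<or> w \<sqsubset> u)}"
  have S: "finite (?h ` ?S)" "?h ` ?S \<noteq> {}"
    using assms finite_carrier by auto
  obtain u where u: "u \<in> ?S" "?h u = Max (?h ` ?S)"
    using Max_in[OF S] by (metis (no_types, lifting) imageE)
  have "\<not> (u \<sqsubset> x \<and> x \<sqsubset> v)" if "x \<in> P" for x
  proof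
    assume x: "u \<sqsubset> x \<and> x \<sqsubset> v"
    then have "x \<in> ?S"
      using u(1) that by (auto intro: lt_trans)
    then have "?h x \<le> ?h u"
      unfolding u(2) using S(1) by (intro Max_ge) auto
    moreover have "?h u < ?h x"
      using u(1) x by (intro card_down_less) auto
    ultimately show False
      by simp
  qed
  with u(1) assms(2) show ?thesis
    by (auto simp: covers_def)
qed

text \<open>By transitivity only the head has to be compared with \<open>v\<close>. The case
  \<open>vs = []\<close> stands apart because \<open>chains_below\<close> contains nonempty lists
  only.\<close>

lemma chains_below_Cons_iff:
  "w # vs \<in> chains_below v \<longleftrightarrow> w \<in> P \<and> w \<sqsubset> v \<and> (vs = [] \<or> vs \<in> chains_below w)"
  by (auto simp: chains_below_def intro: lt_trans)

text \<open>A chain with top \<open>w\<close> weighs at most \<open>f w\<close>, and by monotonicity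
  \<open>f w\<close> is at most the value of \<open>f\<close> at some element covered by
  \<open>v\<close>. Conversely, each covered element is the top of a chain whose weight is its
  value. The weight \<open>g\<close> will be the absolute value of the enriched transfer.\<close>

lemma Max_chains_below_eq_Max_covers:
  fixes g f :: "'a \<Rightarrow> real"
  assumes f: "f \<in> order_polytope" and v: "v \<in> P" "\<not> minimal v"
    and le: "\<And>w vs. w # vs \<in> chains_below v \<Longrightarrow> (\<Sum>x\<leftarrow>w # vs. g x) \<le> f w"
    and attained: "\<And>w. w \<in> P \<Longrightarrow> w \<sqsubset> v \<Longrightarrow> \<exists>vs. w # vs \<in> chains_below v \<and> (\<Sum>x\<leftarrow>w # vs. g x) = f w"
  shows "Max ((\<lambda>vs. \<Sum>x\<leftarrow>vs. g x) ` chains_below v) = Max (f ` {w \<in> P. covers v w})"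
    (is "Max ?A = Max ?B")
proof (rule antisym)
  have A: "finite ?A" "?A \<noteq> {}"
    using finite_chains_below chains_below_nonempty[OF v] by auto
  have B: "finite ?B" "?B \<noteq> {}"
    using finite_carrier covered_nonempty[OF v] by auto
  have "(\<Sum>x\<leftarrow>vs. g x) \<le> Max ?B" if "vs \<in> chains_below v" for vs
  proof -
    obtain w ws where vs: "vs = w # ws"
      using \<open>vs \<in> chains_below v\<close> by (cases vs) (auto simp: chains_below_def)
    then have w: "w \<in> P" "w \<sqsubset> v"
      using \<open>vs \<in> chains_below v\<close> by (auto simp: chains_below_Cons_iff)
    then obtain u where u: "covers v u" "w = u \<or> w \<sqsubset> u"
      using ex_cover_above v(1) by blast
    have "u \<in> P"
      using u(1) by (simp add: covers_def)
    have "(\<Sum>x\<leftarrow>vs. g x) \<le> f w"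
      using le that unfolding vs by blast
    also have "f w \<le> f u"
      using f u(2) w(1) \<open>u \<in> P\<close> by (auto simp: order_polytope_def)
    also have "f u \<le> Max ?B"
      using B(1) u(1) \<open>u \<in> P\<close> by (intro Max_ge) auto
    finally show ?thesis .
  qed
  then show "Max ?A \<le> Max ?B"
    using A by simp
  have "f w \<le> Max ?A" if w: "w \<in> P" "covers v w" for w
  proof -
    obtain vs where "w # vs \<in> chains_below v" "(\<Sum>x\<leftarrow>w # vs. g x) = f w"
      using attained w by (auto simp: covers_def)
    then show ?thesis
      using A(1) by (metis Max_ge imageI)
  qed
  then show "Max ?B \<le> Max ?A"
    using B by simp
qed

text \<open>Monotonicity of \<open>f\<close> bounds the subtracted maximum by \<open>f v\<close>; at
  minimal elements \<open>0 \<le> f v\<close> is used.\<close>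

lemma transfer_nonneg:
  assumes f: "f \<in> order_polytope" and v: "v \<in> P"
  shows "0 \<le> transfer f v"
proof (cases "minimal v")
  case True
  then show ?thesis
    using f v by (simp add: transfer_def order_polytope_def)
next
  case False
  then have "Max (f ` {w \<in> P. covers v w}) \<le> f v"
    using f v finite_carrier covered_nonempty[OF v False]
    by (auto simp: covers_def order_polytope_def)
  with v False show ?thesis
    by (simp add: transfer_def)
qed

text \<open>Equality alone does not carry the induction: the bound on chain weights and its
  attainment at the elements below \<open>v\<close> are what identifies the two maxima at
  \<open>v\<close>.\<close>

lemma enriched_transfer_eq_transfer_at:
  assumes f: "f \<in> order_polytope" and "v \<in> P"
  shows "enriched_transfer f v = transfer f v
    \<and> (\<forall>vs. vs = [] \<or> vs \<in> chains_below v \<longrightarrow> (\<Sum>x\<leftarrow>v # vs. \<bar>enriched_transfer f x\<bar>) \<le> f v)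
    \<and> (\<exists>vs. (vs = [] \<or> vs \<in> chains_below v) \<and> (\<Sum>x\<leftarrow>v # vs. \<bar>enriched_transfer f x\<bar>) = f v)"
  using \<open>v \<in> P\<close>
proof (induction "card {u \<in> P. u \<sqsubset> v}" arbitrary: v rule: less_induct)
  case less
  let ?E = "enriched_transfer f"
  show ?case
  proof (cases "minimal v")
    case True
    then have "vs \<notin> chains_below v" for vs
      by (cases vs) (auto simp: minimal_def chains_below_Cons_iff, simp add: chains_below_def)
    moreover have "?E v = f v" "transfer f v = f v" "0 \<le> f v"
      using True f less.prems
      by (simp_all add: enriched_transfer.simps transfer_def order_polytope_def)
    ultimately show ?thesis
      by simp
  next
    case False
    let ?W = "\<lambda>vs. \<Sum>x\<leftarrow>vs. \<bar>?E x\<bar>"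
    note IH = less.hyps[OF card_down_less]
    have Max_eq: "Max (?W ` chains_below v) = Max (f ` {w \<in> P. covers v w})"
    proof (rule Max_chains_below_eq_Max_covers[OF f less.prems False])
      show "?W (w # vs) \<le> f w" if "w # vs \<in> chains_below v" for w vs
        using IH[of w] that unfolding chains_below_Cons_iff by blast
      show "\<exists>vs. w # vs \<in> chains_below v \<and> ?W (w # vs) = f w" if "w \<in> P" "w \<sqsubset> v" for w
        using IH[of w] that unfolding chains_below_Cons_iff by blast
    qed
    have E: "?E v = f v - Max (?W ` chains_below v)"
      using False less.prems by (simp add: enriched_transfer.simps[of f v])
    then have eq: "?E v = transfer f v"
      using False less.prems Max_eq by (simp add: transfer_def)
    then have nonneg: "0 \<le> ?E v"
      using transfer_nonneg[OF f less.prems] by simp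
    have fin: "finite (?W ` chains_below v)" "?W ` chains_below v \<noteq> {}"
      using finite_chains_below chains_below_nonempty[OF less.prems False] by auto
    \<comment> \<open>Needed for the one-element chain: for \<open>vs = []\<close> the weight
      \<open>?W vs\<close> is 0 and is not among the values maximised.\<close>
    have Max_nonneg: "0 \<le> Max (?W ` chains_below v)"
    proof -
      obtain vs where "Max (?W ` chains_below v) = ?W vs"
        using Max_in[OF fin] by blast
      moreover have "0 \<le> ?W vs"
        by (rule sum_list_nonneg) auto
      ultimately show ?thesis
        by simp
    qed
    \<comment> \<open>Since \<open>?E v\<close> is nonnegative, its absolute value is
      \<open>f v\<close> minus the maximum, and adding a weight at most that maximum gives at most
      \<open>f v\<close>.\<close>
    have "?W (v # vs) \<le> f v" if "vs = [] \<or> vs \<in> chains_below v" for vs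
    proof -
      have "?W vs \<le> Max (?W ` chains_below v)"
        using that Max_nonneg fin(1) by (auto intro: Max_ge)
      then show ?thesis
        using E nonneg by simp
    qed
    \<comment> \<open>Prefixing \<open>v\<close> to a heaviest chain below it cancels the subtracted
      maximum exactly.\<close>
    moreover obtain vs where "vs \<in> chains_below v" "?W vs = Max (?W ` chains_below v)"
      using Max_in[OF fin] by auto
    then have "vs \<in> chains_below v" "?W (v # vs) = f v"
      using E nonneg by simp_all
    ultimately show ?thesis
      using eq by blast
  qed
qed

text \<open>Outside \<open>P\<close> both functions are \<open>undefined\<close>, so agreement on
  \<open>P\<close> is equality in HOL.\<close>

lemma enriched_transfer_eq_transfer:
  assumes "f \<in> order_polytope"
  shows "enriched_transfer f = transfer f"
proof
  fix v
  show "enriched_transfer f v = transfer f v"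
    using enriched_transfer_eq_transfer_at[OF assms, of v]
    by (cases "v \<in> P") (simp_all add: enriched_transfer.simps[of f v] transfer_def)
qed

end

theorem proposition2p7:
  fixes P :: "'a set" and r :: "'a rel"
  assumes "finite_poset P r"
  shows "restrict (finite_poset.enriched_transfer P r) (finite_poset.order_polytope P r)
       = restrict (finite_poset.transfer P r) (finite_poset.order_polytope P r)"
  by (rule restrict_ext) (rule finite_poset.enriched_transfer_eq_transfer[OF assms])

end
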